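(* Let $n\ge 1$ be an integer and let $N^n\subset\mathbb{R}^{n+2}$ be a closed $n$-dimensional submanifold that is cubical, i.e. contained in the $n$-skeleton $\mathcal{S}^n$ of the canonical cubulation $\mathcal{C}^{n+2}$ of $\mathbb{R}^{n+2}$. Then there exists an isotopic copy of $N^n$ contained in the Menger continuum $M^{n+2}_n$; that is, there is a subset $N'\subset M^{n+2}_n\subset\mathbb{R}^{n+2}$ such that $N^n$ and $N'$ are ambiently isotopic in $\mathbb{R}^{n+2}$.
   Context: Canonical cubulation: $\mathcal{C}^{n+2}$ is the decomposition of $\mathbb{R}^{n+2}$ into the hypercubes that are the images of the unit cube $I^{n+2}=[0,1]^{n+2}$ under translations by vectors with integer coefficients. Its $k$-skeleton $\mathcal{C}^{n+2}_k$ is the union of all $k$-dimensional faces of these hypercubes. The $n$-skeleton $\mathcal{S}^n:=\mathcal{C}^{n+2}_n$ is called the canonical scaffolding of $\mathbb{R}^{n+2}$. Cubical submanifold: a closed (compact, without boundary) $n$-dimensional submanifold of $\mathbb{R}^{n+2}$ that is contained in $\mathcal{S}^n$. Menger continuum: let $Q=[0,1]^{n+2}$. Subdivide $Q$ into $3^{n+2}$ congruent closed subcubes indexed by $(a_1,\ldots,a_{n+2})\in\{0,1,2\}^{n+2}$, where $a_i=0,1,2$ means that the $i$-th coordinate ranges over $[0,1/3]$, $[1/3,2/3]$, $[2/3,1]$ respectively. Put $M^{n+2}_n(0)=Q$, and let $M^{n+2}_n(1)$ be the union of those closed subcubes for which at most $n$ of the indices $a_i$ are equal to $1$. The same rule is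 iterated inside every retained cube: $M^{n+2}_n(r+1)$ is obtained from $M^{n+2}_n(r)$ by replacing each retained closed cube of side $3^{-r}$ by its scaled copy of $M^{n+2}_n(1)$. The Menger continuum is $M^{n+2}_n=\bigcap_{r\ge 0}M^{n+2}_n(r)\subset\mathbb{R}^{n+2}$. Ambient isotopy: two subsets $A,B\subset\mathbb{R}^{n+2}$ are ambiently isotopic if there is a continuous map $H:\mathbb{R}^{n+2}\times[0,1]\to\mathbb{R}^{n+2}$ such that each $H_t=H(\cdot,t)$ is a homeomorphism of $\mathbb{R}^{n+2}$, $H_0=\mathrm{id}$, and $H_1(A)=B$. *)

theory Defs
  imports "HOL-Analysis.Analysis"
begin

definition canonical_cubulation :: "(real ^ 'd) set set" where
  "canonical_cubulation =
     {(+) v ` cbox (\<chi> i. 0) (\<chi> i. 1) | v. \<forall>i. v $ i \<in> \<int>}"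

definition cubulation_skeleton :: "nat \<Rightarrow> (real ^ 'd) set" where
  "cubulation_skeleton k =
     \<Union>{F. \<exists>C \<in> canonical_cubulation. F face_of C \<and> aff_dim F = int k}"

(* Submanifolds are topological: no smoothness and no local flatness is required.  As charts map
   into all of R^k, there is no boundary.  Hausdorffness and second countability are inherited
   from the ambient space. *)
definition closed_submanifold :: "nat \<Rightarrow> (real ^ 'd) set \<Rightarrow> bool" where
  "closed_submanifold k N \<longleftrightarrow>
     compact N \<and>
     (\<forall>x \<in> N. \<exists>U V. openin (top_of_set N) U \<and> x \<in> U \<and> openin (Euclidean_space k) V \<and>
        top_of_set U homeomorphic_space subtopology (Euclidean_space k) V)"

definition cubical_submanifold :: "nat \<Rightarrow> (real ^ 'd) set \<Rightarrow> bool" where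
  "cubical_submanifold k N \<longleftrightarrow> closed_submanifold k N \<and> N \<subseteq> cubulation_skeleton k"

definition menger_indices :: "nat \<Rightarrow> ('d::finite \<Rightarrow> nat) set" where
  "menger_indices k = {a. (\<forall>i. a i \<in> {0, 1, 2}) \<and> card {i. a i = 1} \<le> k}"

(* The corners with least coordinates of the cubes of side 3^(-r) retained after r subdivisions. *)
primrec menger_corners :: "nat \<Rightarrow> nat \<Rightarrow> (real ^ 'd) set" where
  "menger_corners k 0 = {0}"
| "menger_corners k (Suc r) =
     {c + (1 / 3) ^ Suc r *\<^sub>R (\<chi> i. real (a i)) | c a.
        c \<in> menger_corners k r \<and> a \<in> menger_indices k}"

definition menger_stage :: "nat \<Rightarrow> nat \<Rightarrow> (real ^ 'd) set" where
  "menger_stage k r = (\<Union>c \<in> menger_corners k r. cbox c (c + (1 / 3) ^ r *\<^sub>R (\<chi> i. 1)))"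

definition menger_continuum :: "nat \<Rightarrow> (real ^ 'd) set" where
  "menger_continuum k = (\<Inter>r. menger_stage k r)"

definition ambient_isotopic :: "'a::topological_space set \<Rightarrow> 'a set \<Rightarrow> bool" where
  "ambient_isotopic A B \<longleftrightarrow>
     (\<exists>H :: 'a \<times> real \<Rightarrow> 'a.
        continuous_on (UNIV \<times> {0..1}) H \<and>
        (\<forall>t \<in> {0..1}. \<exists>g. homeomorphism UNIV UNIV (\<lambda>x. H (x, t)) g) \<and>
        (\<forall>x. H (x, 0) = x) \<and>
        (\<lambda>x. H (x, 1)) ` A = B)"

end

(* A point of the n-skeleton has at least two integer coordinates, whereas a point of the unit cube
   lies in the Menger continuum as soon as two of its coordinates lie in the Cantor set.  So it is
   enough to move, in each coordinate separately, the line by an increasing homeomorphism that takes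
   [-m, m] into [0, 1] and the integers there into the Cantor set.  Such a map is isotopic to the
   identity by linear interpolation. *)
theory Submission
  imports Defs
begin

text \<open>At a noninteger coordinate the point \<open>x\<close> lies strictly between two opposite
  facets of the cube, so a short segment centred at \<open>x\<close> in that axis direction stays in
  \<open>C\<close>. A face that meets the interior of a segment of \<open>C\<close> contains its
  endpoints, so each such axis is a direction of \<open>F\<close>. Distinct axes are
  independent.\<close>

lemma card_nonint_coords_le_aff_dim:
  fixes F :: "(real ^ 'd) set"
  assumes C: "C \<in> canonical_cubulation" and F: "F face_of C" and x: "x \<in> F"
  shows "int (card {i. x $ i \<notin> \<int>}) \<le> aff_dim F"
proof -
  obtain v :: "real ^ 'd" where v: "\<And>i. v $ i \<in> \<int>" and Cv: "C = (+) v ` cbox (\<chi> i. 0) (\<chi> i. 1)"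
    using C by (auto simp: canonical_cubulation_def)
  have mem_C: "y \<in> C \<longleftrightarrow> (\<forall>i. v $ i \<le> y $ i \<and> y $ i \<le> v $ i + 1)" for y
  proof -
    have "y \<in> C \<longleftrightarrow> y - v \<in> cbox (\<chi> i. 0) (\<chi> i. 1)"
      unfolding Cv by (force simp: image_iff algebra_simps)
    then show ?thesis by (simp add: mem_box_cart algebra_simps)
  qed
  have xC: "x \<in> C" using F x face_of_imp_subset by blast
  let ?T = "(+) (- x) ` F"
  have axis_mem: "axis i 1 \<in> span ?T" if i: "x $ i \<notin> \<int>" for i
  proof -
    have "x $ i \<noteq> v $ i" "x $ i \<noteq> v $ i + 1"
      using i v[of i] by auto
    then have lt: "v $ i < x $ i" "x $ i < v $ i + 1"
      using xC mem_C by (metis order_le_less)+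
    \<comment> \<open>The distance from \<open>x $ i\<close> to the nearer end of its interval: both
      \<open>?p\<close> and \<open>?q\<close> remain in the cube, and \<open>x\<close> is their
      midpoint.\<close>
    define e where "e = min (x $ i - v $ i) (v $ i + 1 - x $ i)"
    have e: "e > 0" "v $ i \<le> x $ i - e" "x $ i + e \<le> v $ i + 1" using lt by (auto simp: e_def)
    let ?p = "x + e *\<^sub>R axis i 1" and ?q = "x - e *\<^sub>R axis i (1::real)"
    have "?p \<in> C" "?q \<in> C"
      using xC e lt unfolding mem_C by (auto simp: axis_def)
    moreover have "?p \<noteq> ?q"
      using e(1) by (auto simp: vec_eq_iff axis_def)
    then have "x \<in> open_segment ?p ?q"
      unfolding in_segment
      by (intro conjI exI[of _ "1/2"]) (simp_all add: vec_eq_iff field_simps)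
    ultimately have "?p \<in> F"
      using F x unfolding face_of_def by blast
    then have "e *\<^sub>R axis i 1 \<in> ?T"
      by (auto simp: image_iff intro: bexI[of _ ?p])
    then have "(1 / e) *\<^sub>R (e *\<^sub>R axis i 1) \<in> span ?T"
      by (intro span_scale span_base)
    then show ?thesis using e(1) by simp
  qed
  let ?B = "(\<lambda>i. axis i (1::real)) ` {i. x $ i \<notin> \<int>}"
  have "?B \<subseteq> Basis" by (auto simp: axis_in_Basis_iff)
  then have "independent ?B"
    using independent_Basis independent_mono by blast
  then have "card ?B \<le> dim (span ?T)"
    using axis_mem by (intro independent_card_le_dim) auto
  moreover have "card ?B = card {i. x $ i \<notin> \<int>}"
    by (intro card_image) (simp add: inj_on_def axis_eq_axis)
  moreover have "aff_dim F = int (dim ?T)"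
    using x by (intro aff_dim_eq_dim hull_inc)
  ultimately show ?thesis by (simp add: dim_span)
qed

lemma card_nonint_coords_cubulation_skeleton:
  assumes "x \<in> cubulation_skeleton k"
  shows "card {i. (x :: real ^ 'd) $ i \<notin> \<int>} \<le> k"
proof -
  obtain F C where "C \<in> canonical_cubulation" "F face_of C" "aff_dim F = int k" "x \<in> F"
    using assms unfolding cubulation_skeleton_def by blast
  then show ?thesis
    using card_nonint_coords_le_aff_dim[of C F x] by simp
qed

(* Z plays the role of the Cantor set: the first hypothesis strips a leading ternary digit 0 or 2. *)
lemma menger_continuumI:
  fixes x :: "real ^ 'd"
  assumes Z: "\<And>y. y \<in> Z \<Longrightarrow> 3 * y \<in> Z \<or> 3 * y - 2 \<in> Z"
    and x01: "\<And>i. 0 \<le> x $ i \<and> x $ i \<le> 1"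
    and Z01: "\<And>y. y \<in> Z \<Longrightarrow> 0 \<le> y \<and> y \<le> 1"
    and card: "card {i. x $ i \<notin> Z} \<le> k"
  shows "x \<in> menger_continuum k"
proof -
  \<comment> \<open>The quantity \<open>3 ^ r * (x $ i - c $ i)\<close> is the position of
    \<open>x\<close> in the retained cube at \<open>c\<close>, rescaled to the unit cube. Carrying
    membership in \<open>Z\<close> through the induction keeps the digit 1 avoidable in these
    coordinates at every stage.\<close>
  have "\<exists>c \<in> menger_corners k r. \<forall>i. 0 \<le> 3 ^ r * (x $ i - c $ i) \<and> 3 ^ r * (x $ i - c $ i) \<le> 1
          \<and> (x $ i \<in> Z \<longrightarrow> 3 ^ r * (x $ i - c $ i) \<in> Z)" for r
  proof (induction r)
    case 0
    show ?case using x01 by simp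
  next
    case (Suc r)
    then obtain c where c: "c \<in> menger_corners k r"
      and inv: "\<And>i. 0 \<le> 3 ^ r * (x $ i - c $ i) \<and> 3 ^ r * (x $ i - c $ i) \<le> 1"
      and invZ: "\<And>i. x $ i \<in> Z \<Longrightarrow> 3 ^ r * (x $ i - c $ i) \<in> Z"
      by blast
    \<comment> \<open>On a common boundary of two thirds the digit is ambiguous. For points of
      \<open>Z\<close> the hypothesis on \<open>Z\<close> therefore decides it, and the position
      among the thirds only matters outside \<open>Z\<close>.\<close>
    have "\<exists>a::nat. a \<in> {0, 1, 2} \<and> 0 \<le> 3 * y - real a \<and> 3 * y - real a \<le> 1
            \<and> (y \<in> Z \<longrightarrow> a \<noteq> 1 \<and> 3 * y - real a \<in> Z)" if "0 \<le> y" "y \<le> 1" for y :: real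
    proof (cases "y \<in> Z")
      case True
      with Z consider "3 * y \<in> Z" | "3 * y - 2 \<in> Z" by blast
      then show ?thesis
      proof cases
        case 1 then show ?thesis using Z01[OF 1] by (intro exI[of _ 0]) auto
      next
        case 2 then show ?thesis using Z01[OF 2] by (intro exI[of _ 2]) auto
      qed
    next
      case False
      consider "y \<le> 1/3" | "1/3 \<le> y" "y \<le> 2/3" | "2/3 \<le> y" by linarith
      then show ?thesis
      proof cases
        case 1 then show ?thesis using that False by (intro exI[of _ 0]) auto
      next
        case 2 then show ?thesis using that False by (intro exI[of _ 1]) auto
      next
        case 3 then show ?thesis using that False by (intro exI[of _ 2]) auto
      qed
    qed
    then have "\<forall>i. \<exists>a::nat. a \<in> {0, 1, 2} \<and> 0 \<le> 3 * (3 ^ r * (x $ i - c $ i)) - real a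
        \<and> 3 * (3 ^ r * (x $ i - c $ i)) - real a \<le> 1
        \<and> (3 ^ r * (x $ i - c $ i) \<in> Z \<longrightarrow> a \<noteq> 1 \<and> 3 * (3 ^ r * (x $ i - c $ i)) - real a \<in> Z)"
      using inv by blast
    then obtain a :: "'d \<Rightarrow> nat" where a: "\<And>i. a i \<in> {0, 1, 2}"
      and digit: "\<And>i. 0 \<le> 3 * (3 ^ r * (x $ i - c $ i)) - real (a i)
        \<and> 3 * (3 ^ r * (x $ i - c $ i)) - real (a i) \<le> 1"
      and digitZ: "\<And>i. 3 ^ r * (x $ i - c $ i) \<in> Z
        \<Longrightarrow> a i \<noteq> 1 \<and> 3 * (3 ^ r * (x $ i - c $ i)) - real (a i) \<in> Z"
      by metis
    have "{i. a i = 1} \<subseteq> {i. x $ i \<notin> Z}"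
      using invZ digitZ by blast
    then have "card {i. a i = 1} \<le> k"
      using card card_mono[OF finite] order_trans by blast
    then have "a \<in> menger_indices k"
      using a by (simp add: menger_indices_def)
    moreover define c' where "c' = c + (1 / 3) ^ Suc r *\<^sub>R (\<chi> i. real (a i))"
    ultimately have "c' \<in> menger_corners k (Suc r)"
      using c by auto
    \<comment> \<open>Passing to the subcube is the ternary shift: triple the rescaled position and
      subtract the digit.\<close>
    moreover have step: "3 ^ Suc r * (x $ i - c' $ i) = 3 * (3 ^ r * (x $ i - c $ i)) - real (a i)" for i
    proof -
      have "3 ^ Suc r * (x $ i - c' $ i)
          = 3 * (3 ^ r * (x $ i - c $ i)) - (3 ^ Suc r * (1 / 3) ^ Suc r) * real (a i)"
        by (simp add: c'_def algebra_simps)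
      also have "3 ^ Suc r * (1 / 3) ^ Suc r = (1::real)"
        by (simp only: power_mult_distrib[symmetric]) simp
      finally show ?thesis by simp
    qed
    ultimately show ?case
      using digit digitZ invZ by (intro bexI[of _ c']) (unfold step, blast)
  qed
  then have "\<exists>c \<in> menger_corners k r. \<forall>i. 0 \<le> 3 ^ r * (x $ i - c $ i)
      \<and> 3 ^ r * (x $ i - c $ i) \<le> 1" for r
    by meson
  moreover have "x \<in> cbox c (c + (1 / 3) ^ r *\<^sub>R (\<chi> i. 1))"
    if "\<forall>i. 0 \<le> 3 ^ r * (x $ i - c $ i) \<and> 3 ^ r * (x $ i - c $ i) \<le> 1" for c r
  proof -
    have "c $ i \<le> x $ i \<and> x $ i \<le> c $ i + (1 / 3) ^ r" for i
    proof
      show "c $ i \<le> x $ i"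
        using that mult_pos_neg[of "3 ^ r" "x $ i - c $ i"] by (force simp: not_less[symmetric])
      have "x $ i - c $ i \<le> 1 / 3 ^ r"
        using that by (simp add: pos_le_divide_eq mult.commute)
      then show "x $ i \<le> c $ i + (1 / 3) ^ r"
        by (simp add: power_one_over)
    qed
    then show ?thesis by (simp add: mem_box_cart)
  qed
  ultimately have "x \<in> menger_stage k r" for r
    unfolding menger_stage_def by (meson UN_I)
  then show ?thesis
    by (simp add: menger_continuum_def)
qed

text \<open>A convex combination of the identity and \<open>f\<close> is again continuous, strictly
  increasing and unbounded in both directions, so every intermediate map is bijective in each
  coordinate.\<close>

lemma ambient_isotopic_coordinatewise:
  fixes f :: "real \<Rightarrow> real" and A :: "(real ^ 'd) set"
  assumes cont: "continuous_on UNIV f" and mono: "strict_mono f"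
    and top: "filterlim f at_top at_top" and bot: "filterlim f at_bot at_bot"
  shows "ambient_isotopic A ((\<lambda>x. \<chi> i. f (x $ i)) ` A)"
proof -
  define h where "h t s = (1 - t) * s + t * f s" for t s
  define H where "H = (\<lambda>p :: (real ^ 'd) \<times> real. \<chi> i. h (snd p) (fst p $ i))"
  have contH: "continuous_on (UNIV \<times> {0..1}) H"
    unfolding H_def h_def
    by (intro continuous_intros continuous_on_compose2[OF cont]) auto
  have "\<exists>g. homeomorphism UNIV UNIV (\<lambda>x. H (x, t)) g" if t: "t \<in> {0..1}" for t
  proof -
    \<comment> \<open>For \<open>t > 0\<close> strictness comes from \<open>f\<close>, since the
      identity term vanishes at \<open>t = 1\<close>; at \<open>t = 0\<close> it comes from the
      identity.\<close>
    have less: "h t a < h t b" if "a < b" for a b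
    proof (cases "t = 0")
      case False
      then have "t * f a < t * f b" using t strict_monoD[OF mono that] by simp
      moreover have "(1 - t) * a \<le> (1 - t) * b" using t that by (intro mult_left_mono) auto
      ultimately show ?thesis unfolding h_def by linarith
    qed (use that in \<open>simp add: h_def\<close>)
    have surj: "\<exists>s. h t s = y" for y
    proof -
      \<comment> \<open>Bounding the identity along with \<open>f\<close> controls their convex
        combination for the given \<open>t\<close>, and it also yields
        \<open>a \<le> y \<le> b\<close>, as the intermediate value theorem requires.\<close>
      have "eventually (\<lambda>s. s \<ge> y \<and> f s \<ge> y) at_top"
        using top unfolding filterlim_at_top by (intro eventually_conj eventually_ge_at_top) auto
      then obtain b where b: "b \<ge> y" "f b \<ge> y"
        unfolding eventually_at_top_linorder by blast
      have "eventually (\<lambda>s. s \<le> y \<and> f s \<le> y) at_bot"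
        using bot unfolding filterlim_at_bot by (intro eventually_conj eventually_le_at_bot) auto
      then obtain a where a: "a \<le> y" "f a \<le> y"
        unfolding eventually_at_bot_linorder by blast
      have "(1 - t) * a + t * f a \<le> y" "(1 - t) * (- b) + t * (- f b) \<le> - y"
        using t a b by (intro convex_bound_le; simp)+
      then have "h t a \<le> y" "y \<le> h t b"
        by (simp_all add: h_def)
      moreover have "continuous_on {a..b} (h t)"
        unfolding h_def using continuous_on_subset[OF cont] by (intro continuous_intros) auto
      ultimately show ?thesis
        using IVT'[of "h t" a y b] a b by auto
    qed
    have "inj (h t)"
      using less by (metis injI linorder_neqE_linordered_idom order_less_irrefl)
    then have inj: "inj (\<lambda>x. H (x, t))"
      by (auto simp: inj_on_def H_def vec_eq_iff)
    have "surj (\<lambda>x. H (x, t))"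
    proof (rule surjI)
      fix y
      show "H (\<chi> i. SOME s. h t s = y $ i, t) = y"
        using someI_ex[OF surj] by (simp add: H_def vec_eq_iff)
    qed
    \<comment> \<open>Invariance of domain turns the continuous bijection into a homeomorphism, so
      continuity of the inverse needs no separate argument.\<close>
    moreover have "continuous_on UNIV (\<lambda>x. H (x, t))"
      using t by (intro continuous_on_compose2[OF contH] continuous_intros) auto
    ultimately show ?thesis
      using inj invariance_of_domain_homeomorphism[of UNIV "\<lambda>x. H (x, t)"] by auto
  qed
  then show ?thesis
    unfolding ambient_isotopic_def using contH
    by (intro exI[of _ H]) (auto simp: H_def h_def)
qed

theorem theorem1:
  fixes n :: nat and N :: "(real ^ 'd) set"
  assumes "n \<ge> 1"
    and "CARD('d) = n + 2"
    and "cubical_submanifold n N"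
  shows "\<exists>N'. N' \<subseteq> menger_continuum n \<and> ambient_isotopic N N'"
proof -
  have "compact N" and skel: "N \<subseteq> cubulation_skeleton n"
    using assms(3) by (auto simp: cubical_submanifold_def closed_submanifold_def)
  obtain b where b: "\<And>x. x \<in> N \<Longrightarrow> norm x \<le> b"
    using compact_imp_bounded[OF \<open>compact N\<close>] unfolding bounded_iff by blast
  obtain m :: nat where m: "b \<le> real m"
    using real_arch_simple by blast
  have bound: "- real m \<le> x $ i \<and> x $ i \<le> real m" if "x \<in> N" for x i
    using b[OF that] m component_le_norm_cart[of x i] by linarith
  (* The exponential sends -m, ..., m to 1 - 3^(-j), whose ternary digits are 2 (j times), then 0;
     the last summand vanishes on [-m, m] and makes the map onto. *)
  define f :: "real \<Rightarrow> real" where "f s = 1 - 3 powr (- (s + real m)) + max 0 (s - real m)" for s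
  define Z :: "real set" where "Z = range (\<lambda>j::nat. 1 - (1 / 3) ^ j)"
  have cont: "continuous_on UNIV f"
    unfolding f_def by (intro continuous_intros) auto
  have mono: "strict_mono f"
  proof (rule strict_monoI)
    fix s t :: real
    assume "s < t"
    then have "3 powr (- (t + real m)) < (3::real) powr (- (s + real m))" by simp
    with \<open>s < t\<close> show "f s < f t" unfolding f_def by linarith
  qed
  have top: "filterlim f at_top at_top"
  proof (rule filterlim_at_top_mono)
    show "filterlim (\<lambda>s. - real m + s) at_top at_top"
      by (intro filterlim_tendsto_add_at_top[OF tendsto_const] filterlim_ident)
    \<comment> \<open>For \<open>s \<ge> 0\<close> the exponential is at most 1, which leaves at
      least the last summand of \<open>f\<close>.\<close>
    have "- real m + s \<le> f s" if "s \<ge> 0" for s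
    proof -
      have "3 powr (- (s + real m)) \<le> (3::real) powr 0"
        using that by (intro powr_mono) auto
      then show ?thesis unfolding f_def by simp
    qed
    then show "eventually (\<lambda>s. - real m + s \<le> f s) at_top"
      using eventually_ge_at_top[of 0] by (rule eventually_mono[rotated])
  qed
  have bot: "filterlim f at_bot at_bot"
    unfolding filterlim_at_bot
  proof
    fix y :: real
    have "f s \<le> y" if s: "s \<le> - real m" "s \<le> y - real m" for s
    proof -
      \<comment> \<open>With \<open>u = -(s + m) \<ge> 0\<close> and \<open>ln 3 > 1\<close>, the
        power \<open>3 powr u\<close> is at least \<open>1 + u\<close>. The last summand of
        \<open>f\<close> is zero here, hence \<open>f s \<le> -u = s + m \<le> y\<close>.\<close>
      have "1 + - (s + real m) \<le> exp (- (s + real m))" by (rule exp_ge_add_one_self)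
      also have "\<dots> \<le> exp (- (s + real m) * ln 3)"
        using s ln3_gt_1 mult_left_mono[of 1 "ln 3" "- (s + real m)"] by simp
      also have "\<dots> = 3 powr (- (s + real m))" by (simp add: powr_def)
      finally show ?thesis using s unfolding f_def by linarith
    qed
    then show "eventually (\<lambda>s. f s \<le> y) at_bot"
      unfolding eventually_at_bot_linorder
      by (intro exI[of _ "min (- real m) (y - real m)"]) auto
  qed
  have f01: "0 \<le> f s \<and> f s \<le> 1" if "- real m \<le> s" "s \<le> real m" for s
  proof -
    have "3 powr (- (s + real m)) \<le> (3::real) powr 0"
      using that by (intro powr_mono) auto
    then show ?thesis using that by (simp add: f_def)
  qed
  have fZ: "f s \<in> Z" if "- real m \<le> s" "s \<le> real m" "s \<in> \<int>" for s
  proof -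
    obtain j where j: "s = of_int j" using \<open>s \<in> \<int>\<close> by (auto elim: Ints_cases)
    \<comment> \<open>Shifting by \<open>m\<close> makes the exponent a natural number, because
      \<open>s \<ge> -m\<close>.\<close>
    define k where "k = nat (j + int m)"
    have "real_of_int (j + int m) \<ge> 0" using that j by simp
    then have "j + int m \<ge> 0" by linarith
    then have k: "s + real m = real k" by (simp add: k_def j)
    have "f s = 1 - 3 powr (- real k)" using that(2) by (simp add: f_def k)
    also have "3 powr (- real k) = (1 / 3 :: real) ^ k"
      by (simp add: powr_minus powr_realpow power_divide field_simps)
    finally show ?thesis unfolding Z_def by blast
  qed
  have "(\<chi> i. f (x $ i)) \<in> menger_continuum n" if x: "x \<in> N" for x
  proof (rule menger_continuumI[where Z = Z])
    fix y assume "y \<in> Z"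
    then obtain j where y: "y = 1 - (1 / 3) ^ j" by (auto simp: Z_def)
    show "0 \<le> y \<and> y \<le> 1" by (simp add: y power_le_one)
    show "3 * y \<in> Z \<or> 3 * y - 2 \<in> Z"
    \<comment> \<open>For \<open>j = 0\<close> the point is 0, fixed by tripling; otherwise the
      leading digit is 2, and removing it lowers the exponent by one.\<close>
    proof (cases j)
      case 0
      then show ?thesis by (simp add: y Z_def image_iff exI[of _ 0])
    next
      case (Suc l)
      then have "3 * y - 2 = 1 - (1 / 3) ^ l" by (simp add: y)
      then show ?thesis by (simp add: Z_def)
    qed
  next
    show "0 \<le> (\<chi> i. f (x $ i)) $ i \<and> (\<chi> i. f (x $ i)) $ i \<le> 1" for i
      using f01 bound[OF x] by simp
  next
    \<comment> \<open>Integer coordinates of \<open>x\<close> are sent into \<open>Z\<close>, so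
      only the at most \<open>n\<close> noninteger ones can leave it.\<close>
    have "{i. (\<chi> i. f (x $ i)) $ i \<notin> Z} \<subseteq> {i. x $ i \<notin> \<int>}"
      using fZ bound[OF x] by auto
    then have "card {i. (\<chi> i. f (x $ i)) $ i \<notin> Z} \<le> card {i. x $ i \<notin> \<int>}"
      by (intro card_mono) auto
    also have "\<dots> \<le> n"
      using card_nonint_coords_cubulation_skeleton x skel by blast
    finally show "card {i. (\<chi> i. f (x $ i)) $ i \<notin> Z} \<le> n" .
  qed
  then have "(\<lambda>x. \<chi> i. f (x $ i)) ` N \<subseteq> menger_continuum n"
    by (rule image_subsetI)
  with ambient_isotopic_coordinatewise[OF cont mono top bot] show ?thesis
    by (intro exI conjI)
qed

end
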